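(* Let $\mathcal V$ be a variety of algebras of type $\mathcal F$. Given an algebra $A$ in $\mathcal V$, there is a one-to-one correspondence between: (a) the set of all idempotent endomorphisms of $A$; (b) the set of all pairs $(B,\omega)$, where $B$ is a subalgebra of $A$, $\omega$ is a congruence on $A$, and $A=B\ltimes\omega$.
   Context: An endomorphism $e$ of $A$ is idempotent if $e\circ e=e$. For a congruence $\omega$ on $A$, $[a]_\omega$ denotes the congruence class of $a\in A$. For a subalgebra $B$ of $A$ and a congruence $\omega$ on $A$, one says that $A$ is the (inner) semidirect product of $B$ and $\omega$, written $A=B\ltimes\omega$, if $B$ is a set of representatives of the congruence classes of $A$ modulo $\omega$, that is, for every $a\in A$ the intersection $[a]_\omega\cap B$ is a singleton. Equivalently, there is an idempotent endomorphism of $A$ whose image is $B$ and whose kernel (the congruence identifying two elements exactly when they have the same image) is $\omega$. *)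

theory Defs
  imports "HOL-Library.FuncSet"
begin

text \<open>
  A type of algebras. The operation symbols form an explicit set, so that a type without
  operation symbols is covered as well.
\<close>

record 'f alg_type =
  symbols :: "'f set"
  arity :: "'f \<Rightarrow> nat"

record ('f, 'a) alg =
  carrier :: "'a set"
  interp :: "'f \<Rightarrow> 'a list \<Rightarrow> 'a"

definition args :: "'f alg_type \<Rightarrow> 'f \<Rightarrow> 'a set \<Rightarrow> 'a list set" where
  "args F f X = {xs. length xs = arity F f \<and> set xs \<subseteq> X}"

text \<open>
  Empty carriers are not excluded. For an algebra with nonempty carrier this makes no
  difference below, since the subalgebra in a semidirect decomposition meets every
  congruence class and hence is nonempty too.
\<close>

definition is_algebra :: "'f alg_type \<Rightarrow> ('f, 'a) alg \<Rightarrow> bool" where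
  "is_algebra F A \<longleftrightarrow>
    (\<forall>f\<in>symbols F. \<forall>xs\<in>args F f (carrier A). interp A f xs \<in> carrier A)"

datatype 'f trm = Var nat | App 'f "'f trm list"

fun is_term :: "'f alg_type \<Rightarrow> 'f trm \<Rightarrow> bool" where
  "is_term F (Var n) \<longleftrightarrow> True"
| "is_term F (App f ts) \<longleftrightarrow>
    f \<in> symbols F \<and> length ts = arity F f \<and> (\<forall>t\<in>set ts. is_term F t)"

fun eval_trm :: "('f, 'a) alg \<Rightarrow> (nat \<Rightarrow> 'a) \<Rightarrow> 'f trm \<Rightarrow> 'a" where
  "eval_trm A v (Var n) = v n"
| "eval_trm A v (App f ts) = interp A f (map (eval_trm A v) ts)"

definition satisfies :: "('f, 'a) alg \<Rightarrow> 'f trm \<times> 'f trm \<Rightarrow> bool" where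
  "satisfies A = (\<lambda>(s, t).
    \<forall>v. range v \<subseteq> carrier A \<longrightarrow> eval_trm A v s = eval_trm A v t)"

text \<open>
  Varieties are taken as equational classes. A class of algebras is represented by its members
  with carrier in an arbitrary but fixed type; closure under arbitrary direct products
  cannot be expressed inside one such type.
\<close>

definition is_variety :: "'f alg_type \<Rightarrow> ('f, 'a) alg set \<Rightarrow> bool" where
  "is_variety F V \<longleftrightarrow>
    (\<exists>E. (\<forall>(s, t)\<in>E. is_term F s \<and> is_term F t) \<and>
      V = {A. is_algebra F A \<and> (\<forall>eq\<in>E. satisfies A eq)})"

definition is_subalgebra :: "'f alg_type \<Rightarrow> ('f, 'a) alg \<Rightarrow> 'a set \<Rightarrow> bool" where
  "is_subalgebra F A B \<longleftrightarrow>
    B \<subseteq> carrier A \<and> (\<forall>f\<in>symbols F. \<forall>xs\<in>args F f B. interp A f xs \<in> B)"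

definition is_congruence :: "'f alg_type \<Rightarrow> ('f, 'a) alg \<Rightarrow> 'a rel \<Rightarrow> bool" where
  "is_congruence F A \<omega> \<longleftrightarrow>
    equiv (carrier A) \<omega> \<and>
    (\<forall>f\<in>symbols F. \<forall>xs\<in>args F f (carrier A). \<forall>ys\<in>args F f (carrier A).
      list_all2 (\<lambda>x y. (x, y) \<in> \<omega>) xs ys \<longrightarrow> (interp A f xs, interp A f ys) \<in> \<omega>)"

text \<open>
  Endomorphisms are extensional (undefined outside the carrier), so that two of them are
  equal iff they agree on the carrier.
\<close>

definition endomorphisms :: "'f alg_type \<Rightarrow> ('f, 'a) alg \<Rightarrow> ('a \<Rightarrow> 'a) set" where
  "endomorphisms F A =
    {e \<in> carrier A \<rightarrow>\<^sub>E carrier A.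
      \<forall>f\<in>symbols F. \<forall>xs\<in>args F f (carrier A). e (interp A f xs) = interp A f (map e xs)}"

definition idempotent_endomorphisms :: "'f alg_type \<Rightarrow> ('f, 'a) alg \<Rightarrow> ('a \<Rightarrow> 'a) set" where
  "idempotent_endomorphisms F A = {e \<in> endomorphisms F A. compose (carrier A) e e = e}"

definition ker :: "('f, 'a) alg \<Rightarrow> ('a \<Rightarrow> 'b) \<Rightarrow> 'a rel" where
  "ker A e = {(x, y) \<in> carrier A \<times> carrier A. e x = e y}"

definition semidirect :: "'f alg_type \<Rightarrow> ('f, 'a) alg \<Rightarrow> 'a set \<Rightarrow> 'a rel \<Rightarrow> bool" where
  "semidirect F A B \<omega> \<longleftrightarrow>
    is_subalgebra F A B \<and> is_congruence F A \<omega> \<and>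
    (\<forall>a\<in>carrier A. is_singleton (\<omega> `` {a} \<inter> B))"

end

theory Submission
  imports Defs
begin

text \<open>
  An idempotent endomorphism \<open>e\<close> fixes its image pointwise, so each element \<open>a\<close> is congruent
  modulo the kernel to exactly one element of the image, namely \<open>e a\<close>
  (lemma \<open>kernel_class_Int_image\<close>). Hence image and kernel form a semidirect decomposition,
  and they determine \<open>e\<close>: it sends \<open>a\<close> to the representative of the class of \<open>a\<close>.

  Conversely, given \<open>A = B \<ltimes> \<omega>\<close>, send each \<open>a\<close> to its representative in \<open>B\<close>. This map is a
  homomorphism because applying an operation \<open>f\<close> to the representatives of \<open>a\<^sub>1, \<dots>, a\<^sub>n\<close> gives
  an element that lies in \<open>B\<close>, a subalgebra, and is congruent to \<open>f(a\<^sub>1, \<dots>, a\<^sub>n)\<close>, as \<open>\<omega>\<close> is a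
  congruence; so it is the representative of \<open>f(a\<^sub>1, \<dots>, a\<^sub>n)\<close>. It is idempotent because an element
  of \<open>B\<close> represents itself, and its image and kernel are \<open>B\<close> and \<open>\<omega>\<close>. The two constructions are
  therefore mutually inverse.
\<close>

lemma is_algebra_if_in_variety:
  assumes "is_variety F V" "A \<in> V"
  shows "is_algebra F A"
  using assms by (auto simp: is_variety_def)


section \<open>Image and kernel of an endomorphism\<close>

lemma subalgebra_image_endomorphism:
  assumes alg: "is_algebra F A" and e: "e \<in> endomorphisms F A"
  shows "is_subalgebra F A (e ` carrier A)"
  unfolding is_subalgebra_def
proof (intro conjI ballI)
  show "e ` carrier A \<subseteq> carrier A"
    using e by (auto simp: endomorphisms_def)
next
  fix f xs
  assume f: "f \<in> symbols F" and xs: "xs \<in> args F f (e ` carrier A)"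
  then have "xs \<in> lists (e ` carrier A)"
    by (auto simp: args_def)
  then obtain ys where ys: "xs = map e ys" "ys \<in> lists (carrier A)"
    by (auto simp: lists_image)
  then have ys_args: "ys \<in> args F f (carrier A)"
    using xs by (auto simp: args_def)
  then have "interp A f xs = e (interp A f ys)"
    using e f ys by (auto simp: endomorphisms_def)
  moreover have "interp A f ys \<in> carrier A"
    using alg f ys_args by (auto simp: is_algebra_def)
  ultimately show "interp A f xs \<in> e ` carrier A"
    by blast
qed

lemma congruence_ker_endomorphism:
  assumes alg: "is_algebra F A" and e: "e \<in> endomorphisms F A"
  shows "is_congruence F A (ker A e)"
  unfolding is_congruence_def
proof (intro conjI ballI impI)
  show "equiv (carrier A) (ker A e)"
    by (rule equivI) (auto simp: ker_def refl_on_def sym_def trans_def)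
next
  fix f xs ys
  assume f: "f \<in> symbols F"
    and xs: "xs \<in> args F f (carrier A)" and ys: "ys \<in> args F f (carrier A)"
    and rel: "list_all2 (\<lambda>x y. (x, y) \<in> ker A e) xs ys"
  have "map e xs = map e ys"
    using rel by (auto simp: list_all2_conv_all_nth ker_def intro: nth_equalityI)
  then have "e (interp A f xs) = e (interp A f ys)"
    using e f xs ys by (auto simp: endomorphisms_def)
  then show "(interp A f xs, interp A f ys) \<in> ker A e"
    using alg f xs ys by (auto simp: ker_def is_algebra_def)
qed

lemma idempotent_endomorphism_apply:
  assumes "e \<in> idempotent_endomorphisms F A" "a \<in> carrier A"
  shows "e a \<in> carrier A" "e (e a) = e a"
proof -
  show "e a \<in> carrier A"
    using assms by (auto simp: idempotent_endomorphisms_def endomorphisms_def)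
  have "compose (carrier A) e e a = e a"
    using assms by (simp add: idempotent_endomorphisms_def)
  then show "e (e a) = e a"
    using assms by (simp add: compose_eq)
qed

text \<open>
  Idempotence puts \<open>e a\<close> into the class of \<open>a\<close>. Conversely, an element \<open>e b\<close> of the image in
  that class satisfies \<open>e b = e (e b) = e a\<close>.
\<close>

lemma kernel_class_Int_image:
  assumes e: "e \<in> idempotent_endomorphisms F A" and a: "a \<in> carrier A"
  shows "ker A e `` {a} \<inter> e ` carrier A = {e a}"
proof
  show "ker A e `` {a} \<inter> e ` carrier A \<subseteq> {e a}"
    using idempotent_endomorphism_apply(2)[OF e] by (auto simp: ker_def)
  show "{e a} \<subseteq> ker A e `` {a} \<inter> e ` carrier A"
    using a idempotent_endomorphism_apply[OF e a] by (auto simp: ker_def)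
qed

lemma semidirect_image_ker:
  assumes alg: "is_algebra F A" and e: "e \<in> idempotent_endomorphisms F A"
  shows "semidirect F A (e ` carrier A) (ker A e)"
proof -
  have "e \<in> endomorphisms F A"
    using e by (simp add: idempotent_endomorphisms_def)
  then show ?thesis
    using subalgebra_image_endomorphism[OF alg] congruence_ker_endomorphism[OF alg]
    by (auto simp: semidirect_def kernel_class_Int_image[OF e])
qed


section \<open>The projection onto the representatives\<close>

text \<open>
  The projection is made extensional, as endomorphisms are, so that it can be recovered as
  an equal function and not only up to its values on the carrier.
\<close>

definition projection :: "('f, 'a) alg \<Rightarrow> 'a set \<Rightarrow> 'a rel \<Rightarrow> 'a \<Rightarrow> 'a" where
  "projection A B \<omega> = (\<lambda>a\<in>carrier A. the_elem (\<omega> `` {a} \<inter> B))"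

lemma projection_in_class:
  assumes "semidirect F A B \<omega>" "a \<in> carrier A"
  shows "projection A B \<omega> a \<in> B" "(a, projection A B \<omega> a) \<in> \<omega>"
proof -
  have "is_singleton (\<omega> `` {a} \<inter> B)"
    using assms by (simp add: semidirect_def)
  then obtain c where c: "\<omega> `` {a} \<inter> B = {c}"
    by (rule is_singletonE)
  then have "projection A B \<omega> a = c"
    using assms(2) by (simp add: projection_def)
  then have "projection A B \<omega> a \<in> \<omega> `` {a} \<inter> B"
    unfolding c by simp
  then show "projection A B \<omega> a \<in> B" "(a, projection A B \<omega> a) \<in> \<omega>"
    by auto
qed

text \<open>
  This is the uniqueness of representatives. It reduces computing a value of the projection,
  in particular its compatibility with the operations, to exhibiting an element of \<open>B\<close> in the
  right class.
\<close>

lemma projection_eqI: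
  assumes "semidirect F A B \<omega>" "a \<in> carrier A" "b \<in> B" "(a, b) \<in> \<omega>"
  shows "projection A B \<omega> a = b"
proof -
  obtain c where "\<omega> `` {a} \<inter> B = {c}"
    using assms by (auto simp: semidirect_def is_singleton_def)
  moreover from this have "c = b"
    using assms(3,4) by auto
  ultimately show ?thesis
    using assms(2) by (simp add: projection_def)
qed

lemma projection_fixes_representatives:
  assumes sd: "semidirect F A B \<omega>" and b: "b \<in> B"
  shows "projection A B \<omega> b = b"
proof -
  have "b \<in> carrier A"
    using sd b by (auto simp: semidirect_def is_subalgebra_def)
  moreover from this have "(b, b) \<in> \<omega>"
    using sd by (auto simp: semidirect_def is_congruence_def equiv_def refl_on_def)
  ultimately show ?thesis
    using projection_eqI[OF sd] b by blast
qed

lemma projection_in_carrier: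
  assumes "semidirect F A B \<omega>" "a \<in> carrier A"
  shows "projection A B \<omega> a \<in> carrier A"
proof -
  have "B \<subseteq> carrier A"
    using assms(1) by (simp add: semidirect_def is_subalgebra_def)
  then show ?thesis
    using projection_in_class(1)[OF assms] by blast
qed

text \<open>
  Applying \<open>f\<close> to the representatives of the arguments stays in \<open>B\<close> (subalgebra) and in the
  class of the original value (congruence), so the result is the representative of that value.
\<close>

lemma projection_endomorphism:
  assumes alg: "is_algebra F A" and sd: "semidirect F A B \<omega>"
  shows "projection A B \<omega> \<in> endomorphisms F A"
proof -
  have "projection A B \<omega> \<in> carrier A \<rightarrow>\<^sub>E carrier A"
  proof (rule PiE_I)
    show "projection A B \<omega> a \<in> carrier A" if "a \<in> carrier A" for a
      using sd that by (rule projection_in_carrier)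
  qed (simp add: projection_def)
  moreover have "projection A B \<omega> (interp A f xs) = interp A f (map (projection A B \<omega>) xs)"
    if f: "f \<in> symbols F" and xs: "xs \<in> args F f (carrier A)" for f xs
  proof -
    let ?ys = "map (projection A B \<omega>) xs"
    have ys: "?ys \<in> args F f B" "?ys \<in> args F f (carrier A)"
      using xs by (auto simp: args_def
          intro!: projection_in_class(1)[OF sd] projection_in_carrier[OF sd])
    have "list_all2 (\<lambda>x y. (x, y) \<in> \<omega>) xs ?ys"
      using xs by (auto simp: args_def list.rel_map
          intro!: list.rel_refl_strong projection_in_class(2)[OF sd])
    then have "(interp A f xs, interp A f ?ys) \<in> \<omega>"
      using sd f xs ys(2) by (auto simp: semidirect_def is_congruence_def)
    moreover have "interp A f ?ys \<in> B"
      using sd f ys(1) by (auto simp: semidirect_def is_subalgebra_def)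
    moreover have "interp A f xs \<in> carrier A"
      using alg f xs by (auto simp: is_algebra_def)
    ultimately show ?thesis
      using projection_eqI[OF sd] by blast
  qed
  ultimately show ?thesis
    by (simp add: endomorphisms_def)
qed

lemma projection_idempotent_endomorphism:
  assumes "is_algebra F A" and sd: "semidirect F A B \<omega>"
  shows "projection A B \<omega> \<in> idempotent_endomorphisms F A"
proof -
  have "compose (carrier A) (projection A B \<omega>) (projection A B \<omega>) = projection A B \<omega>"
  proof (rule extensionalityI[of _ "carrier A"])
    fix a assume "a \<in> carrier A"
    then show "compose (carrier A) (projection A B \<omega>) (projection A B \<omega>) a = projection A B \<omega> a"
      using projection_fixes_representatives[OF sd] projection_in_class(1)[OF sd]
      by (simp add: compose_eq)
  qed (auto simp: projection_def)
  then show ?thesis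
    using projection_endomorphism[OF assms] by (simp add: idempotent_endomorphisms_def)
qed

lemma image_projection:
  assumes sd: "semidirect F A B \<omega>"
  shows "projection A B \<omega> ` carrier A = B"
proof
  show "projection A B \<omega> ` carrier A \<subseteq> B"
    using projection_in_class(1)[OF sd] by blast
  show "B \<subseteq> projection A B \<omega> ` carrier A"
  proof
    fix b assume "b \<in> B"
    moreover from this have "b \<in> carrier A"
      using sd by (auto simp: semidirect_def is_subalgebra_def)
    ultimately show "b \<in> projection A B \<omega> ` carrier A"
      using projection_fixes_representatives[OF sd] by (metis imageI)
  qed
qed

text \<open>
  Every element is congruent to its representative, so congruent elements share one, and
  elements that share one are congruent by transitivity.
\<close>

lemma ker_projection:
  assumes sd: "semidirect F A B \<omega>"
  shows "ker A (projection A B \<omega>) = \<omega>"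
proof -
  have eq: "equiv (carrier A) \<omega>"
    using sd by (simp add: semidirect_def is_congruence_def)
  then have sym: "sym \<omega>" and trans: "trans \<omega>"
    by (auto simp: equiv_def)
  have "(x, y) \<in> \<omega> \<longleftrightarrow> projection A B \<omega> x = projection A B \<omega> y"
    if x: "x \<in> carrier A" and y: "y \<in> carrier A" for x y
  proof
    assume "(x, y) \<in> \<omega>"
    then have "(x, projection A B \<omega> y) \<in> \<omega>"
      using transD[OF trans] projection_in_class(2)[OF sd y] by blast
    then show "projection A B \<omega> x = projection A B \<omega> y"
      using projection_eqI[OF sd x] projection_in_class(1)[OF sd y] by blast
  next
    assume "projection A B \<omega> x = projection A B \<omega> y"
    then have "(x, projection A B \<omega> y) \<in> \<omega>" "(projection A B \<omega> y, y) \<in> \<omega>"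
      using projection_in_class(2)[OF sd x] symD[OF sym projection_in_class(2)[OF sd y]] by simp_all
    then show "(x, y) \<in> \<omega>"
      by (rule transD[OF trans])
  qed
  moreover have "\<omega> \<subseteq> carrier A \<times> carrier A"
    using eq by (rule equiv_type)
  ultimately show ?thesis
    by (auto simp: ker_def)
qed

lemma projection_image_ker:
  assumes e: "e \<in> idempotent_endomorphisms F A"
  shows "projection A (e ` carrier A) (ker A e) = e"
proof (rule extensionalityI[of _ "carrier A"])
  show "e \<in> extensional (carrier A)"
    using e by (auto simp: idempotent_endomorphisms_def endomorphisms_def PiE_def)
qed (simp_all add: projection_def kernel_class_Int_image[OF e])


section \<open>The correspondence\<close>

theorem corollary3p2:
  fixes F :: "'f alg_type" and V :: "('f, 'a) alg set" and A :: "('f, 'a) alg"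
  assumes "is_variety F V"
    and "A \<in> V"
  shows "\<exists>\<Phi>. bij_betw \<Phi> (idempotent_endomorphisms F A)
            {(B, \<omega>). is_subalgebra F A B \<and> is_congruence F A \<omega> \<and> semidirect F A B \<omega>}
          \<and> (\<forall>e\<in>idempotent_endomorphisms F A. \<Phi> e = (e ` carrier A, ker A e))"
proof -
  have alg: "is_algebra F A"
    using assms by (rule is_algebra_if_in_variety)
  let ?\<Phi> = "\<lambda>e. (e ` carrier A, ker A e)"
  let ?D = "{(B, \<omega>). is_subalgebra F A B \<and> is_congruence F A \<omega> \<and> semidirect F A B \<omega>}"
  have D: "?D = {(B, \<omega>). semidirect F A B \<omega>}"
    by (auto simp: semidirect_def)
  have "bij_betw ?\<Phi> (idempotent_endomorphisms F A) ?D"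
    unfolding D
  proof (rule bij_betw_byWitness[where f' = "\<lambda>(B, \<omega>). projection A B \<omega>"])
    show "\<forall>e\<in>idempotent_endomorphisms F A. (\<lambda>(B, \<omega>). projection A B \<omega>) (?\<Phi> e) = e"
      by (simp add: projection_image_ker)
    show "\<forall>p\<in>{(B, \<omega>). semidirect F A B \<omega>}. ?\<Phi> ((\<lambda>(B, \<omega>). projection A B \<omega>) p) = p"
      by (auto simp: image_projection ker_projection)
    show "?\<Phi> ` idempotent_endomorphisms F A \<subseteq> {(B, \<omega>). semidirect F A B \<omega>}"
      using semidirect_image_ker[OF alg] by auto
    show "(\<lambda>(B, \<omega>). projection A B \<omega>) ` {(B, \<omega>). semidirect F A B \<omega>}
        \<subseteq> idempotent_endomorphisms F A"
      using projection_idempotent_endomorphism[OF alg] by auto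
  qed
  then show ?thesis
    by (intro exI[of _ ?\<Phi>]) simp
qed

end
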